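(* Let $(A,\cdot)$ be a commutative associative algebra over $K$ and let $f,g:A\to A$ be linear maps. Define $[x,y]_{(f,g)}:=x\cdot f(y)+g(x\cdot y)$ for all $x,y\in A$. If $((A,\cdot),f)$ is a Nijenhuis associative algebra (i.e. $f$ is a Nijenhuis operator on $(A,\cdot)$) and $f\circ g=g\circ f$, then $((A,[,]_{(f,g)}),f)$ is a Nijenhuis (special) left Alia algebra.
   Context: All vector spaces are over a field $K$ of characteristic zero. A Nijenhuis operator on an algebra $(A,\diamond)$ (a vector space with a bilinear product) is a linear map $N:A\to A$ with $N(x)\diamond N(y)+N^2(x\diamond y)=N(N(x)\diamond y+x\diamond N(y))$ for all $x,y\in A$. A left Alia algebra is a vector space $A$ with a bilinear map $[,]:A\otimes A\to A$ satisfying $[[x,y],z]+[[y,z],x]+[[z,x],y]=[[y,x],z]+[[z,y],x]+[[x,z],y]$ for all $x,y,z\in A$. A Nijenhuis left Alia algebra is a pair $((A,[,]),N)$ with $(A,[,])$ a left Alia algebra and $N$ a Nijenhuis operator on $(A,[,])$. "Special" means that the left Alia bracket has the form $[,]_{(f,g)}$ for a commutative associative product and linear maps $f,g$. *)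

theory Defs
  imports Complex_Main
begin

text \<open>Products need not be unital; the underlying space is the whole type \<open>'a\<close>.\<close>

locale bilinear_algebra = vector_space scale
  for scale :: "'k::field_char_0 \<Rightarrow> 'a::ab_group_add \<Rightarrow> 'a" +
  fixes mult :: "'a \<Rightarrow> 'a \<Rightarrow> 'a"
  assumes linear_left: "Vector_Spaces.linear scale scale (\<lambda>x. mult x y)"
    and linear_right: "Vector_Spaces.linear scale scale (\<lambda>y. mult x y)"

locale assoc_algebra = bilinear_algebra +
  assumes assoc: "mult (mult x y) z = mult x (mult y z)"

locale comm_assoc_algebra = assoc_algebra +
  assumes comm: "mult x y = mult y x"

locale left_Alia_algebra = bilinear_algebra scale bracket
  for scale :: "'k::field_char_0 \<Rightarrow> 'a::ab_group_add \<Rightarrow> 'a"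
    and bracket :: "'a \<Rightarrow> 'a \<Rightarrow> 'a" +
  assumes left_Alia:
    "bracket (bracket x y) z + bracket (bracket y z) x + bracket (bracket z x) y =
     bracket (bracket y x) z + bracket (bracket z y) x + bracket (bracket x z) y"

definition Nijenhuis_operator ::
    "('k::field_char_0 \<Rightarrow> 'a::ab_group_add \<Rightarrow> 'a) \<Rightarrow> ('a \<Rightarrow> 'a \<Rightarrow> 'a) \<Rightarrow> ('a \<Rightarrow> 'a) \<Rightarrow> bool" where
  "Nijenhuis_operator scale mult N \<longleftrightarrow>
     Vector_Spaces.linear scale scale N \<and>
     (\<forall>x y. mult (N x) (N y) + N (N (mult x y)) = N (mult (N x) y + mult x (N y)))"

definition Nijenhuis_assoc_algebra ::
    "('k::field_char_0 \<Rightarrow> 'a::ab_group_add \<Rightarrow> 'a) \<Rightarrow> ('a \<Rightarrow> 'a \<Rightarrow> 'a) \<Rightarrow> ('a \<Rightarrow> 'a) \<Rightarrow> bool" where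
  "Nijenhuis_assoc_algebra scale mult N \<longleftrightarrow>
     assoc_algebra scale mult \<and> Nijenhuis_operator scale mult N"

definition Nijenhuis_left_Alia_algebra ::
    "('k::field_char_0 \<Rightarrow> 'a::ab_group_add \<Rightarrow> 'a) \<Rightarrow> ('a \<Rightarrow> 'a \<Rightarrow> 'a) \<Rightarrow> ('a \<Rightarrow> 'a) \<Rightarrow> bool" where
  "Nijenhuis_left_Alia_algebra scale bracket N \<longleftrightarrow>
     left_Alia_algebra scale bracket \<and> Nijenhuis_operator scale bracket N"

definition special_bracket ::
    "('a::ab_group_add \<Rightarrow> 'a \<Rightarrow> 'a) \<Rightarrow> ('a \<Rightarrow> 'a) \<Rightarrow> ('a \<Rightarrow> 'a) \<Rightarrow> 'a \<Rightarrow> 'a \<Rightarrow> 'a" where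
  "special_bracket mult f g x y = mult x (f y) + g (mult x y)"

definition special_left_Alia_algebra ::
    "('k::field_char_0 \<Rightarrow> 'a::ab_group_add \<Rightarrow> 'a) \<Rightarrow> ('a \<Rightarrow> 'a \<Rightarrow> 'a) \<Rightarrow> bool" where
  "special_left_Alia_algebra scale bracket \<longleftrightarrow>
     left_Alia_algebra scale bracket \<and>
     (\<exists>mult f g. comm_assoc_algebra scale mult \<and>
        Vector_Spaces.linear scale scale f \<and> Vector_Spaces.linear scale scale g \<and>
        bracket = special_bracket mult f g)"

end

theory Submission
  imports Defs
begin

text \<open>
  Both parts are formal cancellations, once the bracket is split into the summands
  \<open>x f(y)\<close> and \<open>g(x y)\<close>.

  Left Alia identity: because \<open>g(x y)\<close> is symmetric in \<open>x\<close> and \<open>y\<close>, the commutator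
  \<open>[x, y] - [y, x]\<close> is \<open>x f(y) - y f(x)\<close>, in which \<open>g\<close> no longer occurs. By bilinearity the
  left Alia identity says that the cyclic sum of \<open>[[x, y] - [y, x], z]\<close> vanishes. That sum is
  the cyclic sum of \<open>(x f(y) - y f(x)) f(z)\<close> plus \<open>g\<close> of the cyclic sum of
  \<open>(x f(y) - y f(x)) z\<close>, and each of these cancels in pairs in a commutative associative
  algebra; this is \<open>left_Alia_special_bracket\<close>.

  Nijenhuis identity: the Nijenhuis identity of the product at \<open>(x, f(y))\<close> handles the summand
  \<open>x f(y)\<close>, and \<open>g\<close> applied to the Nijenhuis identity at \<open>(x, y)\<close> handles the summand
  \<open>g(x y)\<close>, since \<open>f\<close> can be moved through \<open>g\<close>; this is \<open>Nijenhuis_special_bracket\<close>.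
\<close>

lemma bilinear_algebra_special_bracket:
  assumes "bilinear_algebra scale mult"
    and f: "Vector_Spaces.linear scale scale f"
    and g: "Vector_Spaces.linear scale scale g"
  shows "bilinear_algebra scale (special_bracket mult f g)"
proof -
  interpret bilinear_algebra scale mult by fact
  interpret vector_space_pair scale scale ..
  have "Vector_Spaces.linear scale scale (\<lambda>x. special_bracket mult f g x y)" for y
    using linear_compose_add[OF linear_left
        Vector_Spaces.linear_compose[OF linear_left g], of "f y" y]
    by (simp add: special_bracket_def o_def)
  moreover have "Vector_Spaces.linear scale scale (\<lambda>y. special_bracket mult f g x y)" for x
    using linear_compose_add[OF Vector_Spaces.linear_compose[OF f linear_right]
        Vector_Spaces.linear_compose[OF linear_right g], of x x]
    by (simp add: special_bracket_def o_def)
  ultimately show ?thesis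
    by (intro bilinear_algebra.intro bilinear_algebra_axioms.intro vector_space_axioms)
qed

lemma special_bracket_commutator:
  assumes "comm_assoc_algebra scale mult"
  shows "special_bracket mult f g x y - special_bracket mult f g y x
    = mult x (f y) - mult y (f x)"
  using comm_assoc_algebra.comm[OF assms, of x y] by (simp add: special_bracket_def)

text \<open>
  Moving everything to one side turns the left Alia identity into a statement about commutators.
  The six terms left after expanding either cyclic sum below fall into three pairs, which differ
  only in the order of their factors and in sign.
\<close>

lemma left_Alia_special_bracket:
  assumes A: "comm_assoc_algebra scale mult"
    and f: "Vector_Spaces.linear scale scale f"
    and g: "Vector_Spaces.linear scale scale g"
  shows "left_Alia_algebra scale (special_bracket mult f g)"
proof -
  interpret comm_assoc_algebra scale mult by fact
  interpret B: bilinear_algebra scale "special_bracket mult f g"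
    using bilinear_algebra_axioms f g by (rule bilinear_algebra_special_bracket)
  interpret g: Vector_Spaces.linear scale scale g by fact
  let ?b = "special_bracket mult f g"
  let ?w = "\<lambda>x y. mult x (f y) - mult y (f x)"
  interpret A: abel_semigroup mult
    by unfold_locales (rule assoc, rule comm)
  have diff_left: "mult (a - b) c = mult a c - mult b c" for a b c
    using Vector_Spaces.linear.axioms(3)[OF linear_left, THEN module_hom.diff] .
  have diff_right: "mult c (a - b) = mult c a - mult c b" for a b c
    using Vector_Spaces.linear.axioms(3)[OF linear_right, THEN module_hom.diff] .
  have bracket_diff_left: "?b (a - b) c = ?b a c - ?b b c" for a b c
    using Vector_Spaces.linear.axioms(3)[OF B.linear_left, THEN module_hom.diff] .
  have cyclic_f: "mult (?w x y) (f z) + mult (?w y z) (f x) + mult (?w z x) (f y) = 0" for x y z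
    by (simp add: diff_left diff_right A.commute A.left_commute A.assoc)
  have cyclic_g: "mult (?w x y) z + mult (?w y z) x + mult (?w z x) y = 0" for x y z
    by (simp add: diff_left diff_right A.commute A.left_commute A.assoc)
  show ?thesis
  proof (intro left_Alia_algebra.intro left_Alia_algebra_axioms.intro B.bilinear_algebra_axioms)
    fix x y z
    have "?b (?b x y) z + ?b (?b y z) x + ?b (?b z x) y
        - (?b (?b y x) z + ?b (?b z y) x + ?b (?b x z) y)
      = ?b (?b x y - ?b y x) z + ?b (?b y z - ?b z y) x + ?b (?b z x - ?b x z) y"
      by (simp add: bracket_diff_left)
    also have "\<dots> = ?b (?w x y) z + ?b (?w y z) x + ?b (?w z x) y"
      by (simp only: special_bracket_commutator[OF A])
    also have "\<dots> = (mult (?w x y) (f z) + mult (?w y z) (f x) + mult (?w z x) (f y))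
        + g (mult (?w x y) z + mult (?w y z) x + mult (?w z x) y)"
      by (simp add: special_bracket_def g.add)
    also have "\<dots> = 0"
      by (simp only: cyclic_f cyclic_g g.zero) simp
    finally show "?b (?b x y) z + ?b (?b y z) x + ?b (?b z x) y
        = ?b (?b y x) z + ?b (?b z y) x + ?b (?b x z) y"
      by simp
  qed
qed

text \<open>
  The identity to be proved is additive in the bracket, and each of the two summands
  \<open>x f(y)\<close> and \<open>g(x y)\<close>, taken as a bracket of its own, already satisfies it.
\<close>

lemma Nijenhuis_special_bracket:
  assumes N: "Nijenhuis_operator scale mult f"
    and g: "Vector_Spaces.linear scale scale g"
    and comm: "f \<circ> g = g \<circ> f"
  shows "Nijenhuis_operator scale (special_bracket mult f g) f"
proof -
  have f: "Vector_Spaces.linear scale scale f"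
    and Nij: "mult (f x) (f y) + f (f (mult x y)) = f (mult (f x) y + mult x (f y))" for x y
    using N by (auto simp: Nijenhuis_operator_def)
  interpret f: Vector_Spaces.linear scale scale f by fact
  interpret g: Vector_Spaces.linear scale scale g by fact
  have fg: "f (g x) = g (f x)" for x
    using comm by (metis comp_apply)
  let ?b = "special_bracket mult f g"
  have "?b (f x) (f y) + f (f (?b x y)) = f (?b (f x) y + ?b x (f y))" for x y
  proof -
    have "?b (f x) (f y) + f (f (?b x y))
        = (mult (f x) (f (f y)) + f (f (mult x (f y))))
          + g (mult (f x) (f y) + f (f (mult x y)))"
      by (simp add: special_bracket_def f.add g.add fg)
    \<comment> \<open>the first group is an instance at \<open>(x, f y)\<close>, the second at \<open>(x, y)\<close> under \<open>g\<close>\<close>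
    also have "\<dots> = f (mult (f x) (f y) + mult x (f (f y)))
          + g (f (mult (f x) y + mult x (f y)))"
      by (simp only: Nij)
    also have "\<dots> = f (?b (f x) y + ?b x (f y))"
      by (simp add: special_bracket_def f.add g.add fg)
    finally show ?thesis .
  qed
  with f show ?thesis
    by (simp add: Nijenhuis_operator_def)
qed

theorem theorem4p4:
  fixes scale :: "'k::field_char_0 \<Rightarrow> 'a::ab_group_add \<Rightarrow> 'a"
    and mult :: "'a \<Rightarrow> 'a \<Rightarrow> 'a"
    and f g :: "'a \<Rightarrow> 'a"
  assumes "comm_assoc_algebra scale mult"
    and "Vector_Spaces.linear scale scale f"
    and "Vector_Spaces.linear scale scale g"
    and "Nijenhuis_assoc_algebra scale mult f"
    and "f \<circ> g = g \<circ> f"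
  shows "Nijenhuis_left_Alia_algebra scale (special_bracket mult f g) f \<and>
         special_left_Alia_algebra scale (special_bracket mult f g)"
proof
  have Alia: "left_Alia_algebra scale (special_bracket mult f g)"
    using assms(1-3) by (rule left_Alia_special_bracket)
  have "Nijenhuis_operator scale mult f"
    using assms(4) by (simp add: Nijenhuis_assoc_algebra_def)
  then have "Nijenhuis_operator scale (special_bracket mult f g) f"
    using assms(3,5) by (rule Nijenhuis_special_bracket)
  with Alia show "Nijenhuis_left_Alia_algebra scale (special_bracket mult f g) f"
    by (simp add: Nijenhuis_left_Alia_algebra_def)
  show "special_left_Alia_algebra scale (special_bracket mult f g)"
    unfolding special_left_Alia_algebra_def using Alia assms(1-3) by blast
qed

end
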